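(* Let $\mathbf{P} \colon \mathsf{C}^{\mathrm{op}} \to \mathsf{BA}$ be a Boolean doctrine, let $(F_X)_{X \in \mathsf{C}}$ be a universal filter for $\mathbf{P}$ and let $(I_X)_{X \in \mathsf{C}}$ be a universal ideal for $\mathbf{P}$. Suppose that, for all $X\in\mathsf{C}$, $F_X\cap I_X=\varnothing$. Then there is a universal ultrafilter $(G_X)_{X\in\mathsf{C}}$ for $\mathbf{P}$ such that, for all $X \in \mathsf{C}$, $F_X \subseteq G_X$ and $G_X \cap I_X = \varnothing$.
   Context: $\mathsf{BA}$ denotes the category of Boolean algebras and Boolean homomorphisms. A Boolean doctrine over a category $\mathsf{C}$ with finite products is a functor $\mathbf{P} \colon \mathsf{C}^{\mathrm{op}} \to \mathsf{BA}$; $\mathbf{t}$ denotes the terminal object of $\mathsf{C}$ and $\mathrm{pr}_i$ the product projections. A universal filter for $\mathbf{P}$ is a family $(F_X)_{X \in \mathsf{C}}$ with $F_X \subseteq \mathbf{P}(X)$ such that: (a) for all $f \colon X \to Y$ and $\alpha \in F_Y$, $\mathbf{P}(f)(\alpha) \in F_X$; (b) each $F_X$ is a filter of $\mathbf{P}(X)$. A universal ideal for $\mathbf{P}$ is a family $(I_X)_{X \in \mathsf{C}}$ with $I_X \subseteq \mathbf{P}(X)$ such that: (a) for all $m \in \mathbb{N}$, morphisms $(f_j \colon X \to Y)_{j = 1, \dots, m}$ and $\alpha \in \mathbf{P}(Y)$, if $\bigwedge_{j = 1}^m \mathbf{P}(f_j)(\alpha) \in I_X$ then $\alpha \in I_Y$;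 (b) each $I_X$ is downward closed; (c) for all $\alpha_1 \in I_{X_1}$ and $\alpha_2 \in I_{X_2}$, $\mathbf{P}(\mathrm{pr}_1)(\alpha_1) \lor \mathbf{P}(\mathrm{pr}_2)(\alpha_2) \in I_{X_1 \times X_2}$; (d) $\bot_{\mathbf{P}(\mathbf{t})} \in I_\mathbf{t}$. A universal ultrafilter for $\mathbf{P}$ is a family $(F_X)_{X \in \mathsf{C}}$ with $F_X \subseteq \mathbf{P}(X)$ such that: (a) for all $f \colon X \to Y$ and $\alpha \in F_Y$, $\mathbf{P}(f)(\alpha) \in F_X$; (b) each $F_X$ is a filter of $\mathbf{P}(X)$; (c) for all $\alpha_1 \in \mathbf{P}(X_1)$ and $\alpha_2 \in \mathbf{P}(X_2)$, if $\mathbf{P}(\mathrm{pr}_1)(\alpha_1)\lor \mathbf{P}(\mathrm{pr}_2)(\alpha_2)\in F_{X_1\times X_2}$ then $\alpha_1 \in F_{X_1}$ or $\alpha_2\in F_{X_2}$; (d) $\bot_{\mathbf{P}(\mathbf{t})}\notin F_\mathbf{t}$. Equivalently, a universal filter whose fiberwise complement is a universal ideal. *)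

theory Defs
  imports "HOL-Algebra.Lattice"
begin

record ('o, 'm) category_data =
  Obj :: "'o set"
  Arr :: "'m set"
  Dom :: "'m \<Rightarrow> 'o"
  Cod :: "'m \<Rightarrow> 'o"
  Id :: "'o \<Rightarrow> 'm"
  Comp :: "'m \<Rightarrow> 'm \<Rightarrow> 'm"

definition Hom :: "('o, 'm, 'r) category_data_scheme \<Rightarrow> 'o \<Rightarrow> 'o \<Rightarrow> 'm set" where
  "Hom C X Y = {f \<in> Arr C. Dom C f = X \<and> Cod C f = Y}"

text \<open>Composition is in the usual order: \<^term>\<open>Comp C g f\<close> is \<open>g \<circ> f\<close>.\<close>

locale category =
  fixes C :: "('o, 'm, 'r) category_data_scheme"
  assumes Dom_Obj: "f \<in> Arr C \<Longrightarrow> Dom C f \<in> Obj C"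
    and Cod_Obj: "f \<in> Arr C \<Longrightarrow> Cod C f \<in> Obj C"
    and Id_Hom: "X \<in> Obj C \<Longrightarrow> Id C X \<in> Hom C X X"
    and Comp_Hom: "\<lbrakk>f \<in> Hom C X Y; g \<in> Hom C Y Z\<rbrakk> \<Longrightarrow> Comp C g f \<in> Hom C X Z"
    and Comp_Id_right: "f \<in> Hom C X Y \<Longrightarrow> Comp C f (Id C X) = f"
    and Comp_Id_left: "f \<in> Hom C X Y \<Longrightarrow> Comp C (Id C Y) f = f"
    and Comp_assoc: "\<lbrakk>f \<in> Hom C W X; g \<in> Hom C X Y; h \<in> Hom C Y Z\<rbrakk>
      \<Longrightarrow> Comp C h (Comp C g f) = Comp C (Comp C h g) f"

text \<open>Finite products are given by a choice of a terminal object and of binary products.\<close>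

record ('o, 'm) fp_category_data = "('o, 'm) category_data" +
  Term :: "'o"
  Prd :: "'o \<Rightarrow> 'o \<Rightarrow> 'o"
  Pr1 :: "'o \<Rightarrow> 'o \<Rightarrow> 'm"
  Pr2 :: "'o \<Rightarrow> 'o \<Rightarrow> 'm"

locale finite_product_category = category C
  for C :: "('o, 'm, 'r) fp_category_data_scheme" +
  assumes Term_Obj: "Term C \<in> Obj C"
    and Term_universal: "X \<in> Obj C \<Longrightarrow> \<exists>!f. f \<in> Hom C X (Term C)"
    and Prd_Obj: "\<lbrakk>X \<in> Obj C; Y \<in> Obj C\<rbrakk> \<Longrightarrow> Prd C X Y \<in> Obj C"
    and Pr1_Hom: "\<lbrakk>X \<in> Obj C; Y \<in> Obj C\<rbrakk> \<Longrightarrow> Pr1 C X Y \<in> Hom C (Prd C X Y) X"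
    and Pr2_Hom: "\<lbrakk>X \<in> Obj C; Y \<in> Obj C\<rbrakk> \<Longrightarrow> Pr2 C X Y \<in> Hom C (Prd C X Y) Y"
    and Prd_universal: "\<lbrakk>f \<in> Hom C Z X; g \<in> Hom C Z Y\<rbrakk>
      \<Longrightarrow> \<exists>!h. h \<in> Hom C Z (Prd C X Y) \<and> Comp C (Pr1 C X Y) h = f \<and> Comp C (Pr2 C X Y) h = g"

text \<open>The one-element algebra is allowed: \<open>\<bottom> = \<top>\<close> is not excluded.\<close>

locale bool_alg = bounded_lattice L for L :: "('a, 'b) gorder_scheme" (structure) +
  assumes meet_join_distrib: "\<lbrakk>x \<in> carrier L; y \<in> carrier L; z \<in> carrier L\<rbrakk>
      \<Longrightarrow> x \<sqinter> (y \<squnion> z) = (x \<sqinter> y) \<squnion> (x \<sqinter> z)"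
    and complement_exists: "x \<in> carrier L
      \<Longrightarrow> \<exists>y \<in> carrier L. x \<sqinter> y = \<bottom> \<and> x \<squnion> y = \<top>"

text \<open>Preservation of complements follows, as complements are unique.\<close>

definition bool_hom ::
  "('a, 'b) gorder_scheme \<Rightarrow> ('c, 'd) gorder_scheme \<Rightarrow> ('a \<Rightarrow> 'c) \<Rightarrow> bool" where
  "bool_hom L M h \<longleftrightarrow>
     h \<in> carrier L \<rightarrow> carrier M \<and>
     (\<forall>x\<in>carrier L. \<forall>y\<in>carrier L. h (x \<sqinter>\<^bsub>L\<^esub> y) = h x \<sqinter>\<^bsub>M\<^esub> h y) \<and>
     (\<forall>x\<in>carrier L. \<forall>y\<in>carrier L. h (x \<squnion>\<^bsub>L\<^esub> y) = h x \<squnion>\<^bsub>M\<^esub> h y) \<and>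
     h \<bottom>\<^bsub>L\<^esub> = \<bottom>\<^bsub>M\<^esub> \<and>
     h \<top>\<^bsub>L\<^esub> = \<top>\<^bsub>M\<^esub>"

text \<open>Filters are not required to be proper.\<close>

definition ba_filter :: "('a, 'b) gorder_scheme \<Rightarrow> 'a set \<Rightarrow> bool" where
  "ba_filter L F \<longleftrightarrow>
     F \<subseteq> carrier L \<and>
     \<top>\<^bsub>L\<^esub> \<in> F \<and>
     (\<forall>x\<in>F. \<forall>y\<in>F. x \<sqinter>\<^bsub>L\<^esub> y \<in> F) \<and>
     (\<forall>x\<in>F. \<forall>y\<in>carrier L. x \<sqsubseteq>\<^bsub>L\<^esub> y \<longrightarrow> y \<in> F)"

text \<open>
  A contravariant functor into Boolean algebras: \<open>P\<close> is its action on objects and \<open>R\<close> its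
  action on morphisms, where only the values of \<open>R f\<close> on the carrier of \<open>P (Cod C f)\<close> matter.
\<close>

locale boolean_doctrine = finite_product_category C
  for C :: "('o, 'm, 'r) fp_category_data_scheme" +
  fixes P :: "'o \<Rightarrow> ('a, 'b) gorder_scheme"
    and R :: "'m \<Rightarrow> 'a \<Rightarrow> 'a"
  assumes P_bool_alg: "X \<in> Obj C \<Longrightarrow> bool_alg (P X)"
    and R_bool_hom: "f \<in> Hom C X Y \<Longrightarrow> bool_hom (P Y) (P X) (R f)"
    and R_Id: "\<lbrakk>X \<in> Obj C; \<alpha> \<in> carrier (P X)\<rbrakk> \<Longrightarrow> R (Id C X) \<alpha> = \<alpha>"
    and R_Comp: "\<lbrakk>f \<in> Hom C X Y; g \<in> Hom C Y Z; \<alpha> \<in> carrier (P Z)\<rbrakk>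
      \<Longrightarrow> R (Comp C g f) \<alpha> = R f (R g \<alpha>)"

definition universal_filter ::
  "('o, 'm, 'r) fp_category_data_scheme \<Rightarrow> ('o \<Rightarrow> ('a, 'b) gorder_scheme) \<Rightarrow> ('m \<Rightarrow> 'a \<Rightarrow> 'a)
    \<Rightarrow> ('o \<Rightarrow> 'a set) \<Rightarrow> bool" where
  "universal_filter C P R F \<longleftrightarrow>
     (\<forall>X\<in>Obj C. \<forall>Y\<in>Obj C. \<forall>f\<in>Hom C X Y. \<forall>\<alpha>\<in>F Y. R f \<alpha> \<in> F X) \<and>
     (\<forall>X\<in>Obj C. ba_filter (P X) (F X))"

text \<open>
  For \<open>m = 0\<close> the meet in the first clause below is the infimum of the empty set, that is, the
  top element of \<open>P X\<close>.
\<close>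

definition universal_ideal ::
  "('o, 'm, 'r) fp_category_data_scheme \<Rightarrow> ('o \<Rightarrow> ('a, 'b) gorder_scheme) \<Rightarrow> ('m \<Rightarrow> 'a \<Rightarrow> 'a)
    \<Rightarrow> ('o \<Rightarrow> 'a set) \<Rightarrow> bool" where
  "universal_ideal C P R I \<longleftrightarrow>
     (\<forall>X\<in>Obj C. I X \<subseteq> carrier (P X)) \<and>
     (\<forall>X\<in>Obj C. \<forall>Y\<in>Obj C. \<forall>(m::nat) (f :: nat \<Rightarrow> 'm). \<forall>\<alpha>\<in>carrier (P Y).
        (\<forall>j\<in>{1..m}. f j \<in> Hom C X Y) \<longrightarrow>
        \<Sqinter>\<^bsub>P X\<^esub> ((\<lambda>j. R (f j) \<alpha>) ` {1..m}) \<in> I X \<longrightarrow> \<alpha> \<in> I Y) \<and>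
     (\<forall>X\<in>Obj C. \<forall>\<alpha>\<in>I X. \<forall>\<beta>\<in>carrier (P X). \<beta> \<sqsubseteq>\<^bsub>P X\<^esub> \<alpha> \<longrightarrow> \<beta> \<in> I X) \<and>
     (\<forall>X1\<in>Obj C. \<forall>X2\<in>Obj C. \<forall>\<alpha>1\<in>I X1. \<forall>\<alpha>2\<in>I X2.
        R (Pr1 C X1 X2) \<alpha>1 \<squnion>\<^bsub>P (Prd C X1 X2)\<^esub> R (Pr2 C X1 X2) \<alpha>2 \<in> I (Prd C X1 X2)) \<and>
     \<bottom>\<^bsub>P (Term C)\<^esub> \<in> I (Term C)"

definition universal_ultrafilter ::
  "('o, 'm, 'r) fp_category_data_scheme \<Rightarrow> ('o \<Rightarrow> ('a, 'b) gorder_scheme) \<Rightarrow> ('m \<Rightarrow> 'a \<Rightarrow> 'a)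
    \<Rightarrow> ('o \<Rightarrow> 'a set) \<Rightarrow> bool" where
  "universal_ultrafilter C P R F \<longleftrightarrow>
     (\<forall>X\<in>Obj C. \<forall>Y\<in>Obj C. \<forall>f\<in>Hom C X Y. \<forall>\<alpha>\<in>F Y. R f \<alpha> \<in> F X) \<and>
     (\<forall>X\<in>Obj C. ba_filter (P X) (F X)) \<and>
     (\<forall>X1\<in>Obj C. \<forall>X2\<in>Obj C. \<forall>\<alpha>1\<in>carrier (P X1). \<forall>\<alpha>2\<in>carrier (P X2).
        R (Pr1 C X1 X2) \<alpha>1 \<squnion>\<^bsub>P (Prd C X1 X2)\<^esub> R (Pr2 C X1 X2) \<alpha>2 \<in> F (Prd C X1 X2) \<longrightarrow>
        \<alpha>1 \<in> F X1 \<or> \<alpha>2 \<in> F X2) \<and>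
     \<bottom>\<^bsub>P (Term C)\<^esub> \<notin> F (Term C)"

end

theory Submission
  imports Defs
begin

text \<open>
  By Zorn's lemma choose \<open>G\<close> maximal among the universal filters that contain \<open>F\<close> and are disjoint
  from \<open>I\<close>. For a fixed \<open>\<rho>\<close> over \<open>Y\<close>, the elements \<open>\<beta>\<close> whose box \<open>pr1 \<beta> \<or> pr2 \<rho>\<close> lies in \<open>G\<close> again
  form a universal filter containing \<open>G\<close>. If \<open>pr1 \<alpha>1 \<or> pr2 \<alpha>2\<close> is in \<open>G\<close> while neither \<open>\<alpha>1\<close> nor \<open>\<alpha>2\<close>
  is, maximality therefore allows \<open>\<alpha>1\<close>, and then \<open>\<alpha>2\<close>, to be replaced by an element of \<open>I\<close>; the
  resulting box lies in both \<open>G\<close> and \<open>I\<close>, a contradiction.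
\<close>

section \<open>Distributivity and order in Boolean algebras\<close>

text \<open>Expanding the left side by \<open>meet_join_distrib\<close> leaves terms that each lie
  below \<open>a \<sqinter> b\<close> or below \<open>r\<close>. This half of the dual distributive
  law is what makes residuals closed under meets.\<close>

lemma (in bool_alg) join_meet_distrib_le:
  assumes a: "a \<in> carrier L" and b: "b \<in> carrier L" and r: "r \<in> carrier L"
  shows "(a \<squnion> r) \<sqinter> (b \<squnion> r) \<sqsubseteq> (a \<sqinter> b) \<squnion> r"
proof -
  let ?t = "(a \<sqinter> b) \<squnion> r"
  have ab: "a \<sqinter> b \<in> carrier L" and br: "b \<sqinter> r \<in> carrier L" and t: "?t \<in> carrier L"
    and x: "a \<squnion> r \<in> carrier L"
    using a b r by auto
  have rt: "r \<sqsubseteq> ?t" using ab r by (rule join_right)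
  have "b \<sqinter> r \<sqsubseteq> ?t" using meet_right[OF b r] rt br r t by (meson le_trans)
  then have "(a \<squnion> r) \<sqinter> b \<sqsubseteq> ?t"
    using meet_join_distrib[OF b a r] join_le[OF join_left[OF ab r] _ ab br t]
    by (simp add: meet_comm)
  moreover have "(a \<squnion> r) \<sqinter> r \<sqsubseteq> ?t"
    using meet_right[OF x r] rt x r t by (meson le_trans meet_closed)
  ultimately show ?thesis
    using meet_join_distrib[OF x b r] x b r t by (simp add: join_le)
qed

lemma (in bool_alg) join_mono_left:
  assumes le: "a \<sqsubseteq> b" and a: "a \<in> carrier L" and b: "b \<in> carrier L" and r: "r \<in> carrier L"
  shows "a \<squnion> r \<sqsubseteq> b \<squnion> r"
proof -
  have br: "b \<squnion> r \<in> carrier L" using b r by (rule join_closed)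
  have "a \<sqsubseteq> b \<squnion> r" using le join_left[OF b r] a b br by (rule le_trans)
  then show ?thesis using join_right[OF b r] a r br by (rule join_le)
qed

lemma ba_filterD:
  assumes "ba_filter L F"
  shows "F \<subseteq> carrier L" "\<top>\<^bsub>L\<^esub> \<in> F"
    "\<And>x y. \<lbrakk>x \<in> F; y \<in> F\<rbrakk> \<Longrightarrow> x \<sqinter>\<^bsub>L\<^esub> y \<in> F"
    "\<And>x y. \<lbrakk>x \<in> F; y \<in> carrier L; x \<sqsubseteq>\<^bsub>L\<^esub> y\<rbrakk> \<Longrightarrow> y \<in> F"
  using assms unfolding ba_filter_def by auto

lemma bool_homD:
  assumes "bool_hom L M h"
  shows "\<And>x. x \<in> carrier L \<Longrightarrow> h x \<in> carrier M"
    "\<And>x y. \<lbrakk>x \<in> carrier L; y \<in> carrier L\<rbrakk> \<Longrightarrow> h (x \<sqinter>\<^bsub>L\<^esub> y) = h x \<sqinter>\<^bsub>M\<^esub> h y"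
    "\<And>x y. \<lbrakk>x \<in> carrier L; y \<in> carrier L\<rbrakk> \<Longrightarrow> h (x \<squnion>\<^bsub>L\<^esub> y) = h x \<squnion>\<^bsub>M\<^esub> h y"
  using assms unfolding bool_hom_def by auto

lemma bool_hom_mono:
  assumes "bool_alg L" "bool_alg M" "bool_hom L M h"
    and "x \<in> carrier L" "y \<in> carrier L" "x \<sqsubseteq>\<^bsub>L\<^esub> y"
  shows "h x \<sqsubseteq>\<^bsub>M\<^esub> h y"
proof -
  interpret L: bool_alg L by fact
  interpret M: bool_alg M by fact
  \<comment> \<open>The order is expressed through joins, which \<open>h\<close> preserves by
    definition.\<close>
  have "x \<squnion>\<^bsub>L\<^esub> y = y" using assms L.le_iff_meet by blast
  then have "h x \<squnion>\<^bsub>M\<^esub> h y = h y" using bool_homD(3)[OF assms(3-5)] by simp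
  then show ?thesis using M.join_left[of "h x" "h y"] bool_homD(1)[OF assms(3)] assms(4,5) by simp
qed

text \<open>Translates between the fiberwise order on families and inclusion of their graphs, the
  form in which Zorn's lemma is applied.\<close>

lemma Sigma_subset_iff: "Sigma A B \<subseteq> Sigma A B' \<longleftrightarrow> (\<forall>x\<in>A. B x \<subseteq> B' x)"
  by auto

section \<open>Boxes and their reindexing\<close>

context boolean_doctrine
begin

text \<open>Logically, the disjunction of \<alpha> and \<beta> in separate variables: the shape
  shared by the join clause of universal ideals and the primeness clause of universal
  ultrafilters.\<close>

definition box :: "'o \<Rightarrow> 'a \<Rightarrow> 'o \<Rightarrow> 'a \<Rightarrow> 'a" where
  "box X \<alpha> Y \<beta> = R (Pr1 C X Y) \<alpha> \<squnion>\<^bsub>P (Prd C X Y)\<^esub> R (Pr2 C X Y) \<beta>"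

lemma R_closed: "\<lbrakk>f \<in> Hom C X Y; \<alpha> \<in> carrier (P Y)\<rbrakk> \<Longrightarrow> R f \<alpha> \<in> carrier (P X)"
  by (rule bool_homD(1)[OF R_bool_hom])

lemma R_mono:
  assumes "f \<in> Hom C X Y" "X \<in> Obj C" "Y \<in> Obj C"
    and "\<alpha> \<in> carrier (P Y)" "\<beta> \<in> carrier (P Y)" "\<alpha> \<sqsubseteq>\<^bsub>P Y\<^esub> \<beta>"
  shows "R f \<alpha> \<sqsubseteq>\<^bsub>P X\<^esub> R f \<beta>"
  using assms by (intro bool_hom_mono[OF P_bool_alg P_bool_alg R_bool_hom])

lemma box_components_closed:
  assumes "X \<in> Obj C" "Y \<in> Obj C" "\<alpha> \<in> carrier (P X)" "\<beta> \<in> carrier (P Y)"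
  shows "R (Pr1 C X Y) \<alpha> \<in> carrier (P (Prd C X Y))"
    "R (Pr2 C X Y) \<beta> \<in> carrier (P (Prd C X Y))"
  using assms by (auto intro: R_closed Pr1_Hom Pr2_Hom)

lemma box_closed:
  assumes "X \<in> Obj C" "Y \<in> Obj C" "\<alpha> \<in> carrier (P X)" "\<beta> \<in> carrier (P Y)"
  shows "box X \<alpha> Y \<beta> \<in> carrier (P (Prd C X Y))"
proof -
  interpret B: bool_alg "P (Prd C X Y)" using assms P_bool_alg Prd_Obj by blast
  show ?thesis unfolding box_def using box_components_closed[OF assms] by simp
qed

text \<open>The witness is the pairing of \<open>f\<close> and \<open>g\<close> given by the
  universal property of the product; functoriality turns its composites with the projections back
  into \<open>f\<close> and \<open>g\<close>.\<close>

lemma R_pair_box: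
  assumes X: "X \<in> Obj C" and Y: "Y \<in> Obj C" and f: "f \<in> Hom C Z X" and g: "g \<in> Hom C Z Y"
    and \<alpha>: "\<alpha> \<in> carrier (P X)" and \<beta>: "\<beta> \<in> carrier (P Y)"
  obtains h where "h \<in> Hom C Z (Prd C X Y)" "R h (box X \<alpha> Y \<beta>) = R f \<alpha> \<squnion>\<^bsub>P Z\<^esub> R g \<beta>"
proof -
  obtain h where h: "h \<in> Hom C Z (Prd C X Y)"
    and fg: "Comp C (Pr1 C X Y) h = f" "Comp C (Pr2 C X Y) h = g"
    using Prd_universal[OF f g] by blast
  have "R h (box X \<alpha> Y \<beta>) = R h (R (Pr1 C X Y) \<alpha>) \<squnion>\<^bsub>P Z\<^esub> R h (R (Pr2 C X Y) \<beta>)"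
    unfolding box_def using bool_homD(3)[OF R_bool_hom[OF h]] box_components_closed[OF X Y \<alpha> \<beta>] .
  also have "\<dots> = R f \<alpha> \<squnion>\<^bsub>P Z\<^esub> R g \<beta>"
    using R_Comp[OF h Pr1_Hom[OF X Y] \<alpha>] R_Comp[OF h Pr2_Hom[OF X Y] \<beta>] fg by simp
  finally show thesis using that h by blast
qed

section \<open>Boxes in universal filters\<close>

lemma universal_filter_closed:
  assumes "universal_filter C P R G" "X \<in> Obj C" "\<alpha> \<in> G X"
  shows "\<alpha> \<in> carrier (P X)"
  using assms unfolding universal_filter_def ba_filter_def by blast

lemma universal_filter_reindex:
  assumes "universal_filter C P R G" "X \<in> Obj C" "Y \<in> Obj C" "f \<in> Hom C X Y" "\<alpha> \<in> G Y"
  shows "R f \<alpha> \<in> G X"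
  using assms unfolding universal_filter_def by blast

text \<open>Reindexing along the pairing of \<open>f\<close> and \<open>g\<close>. Suitable choices
  of the two morphisms swap the factors of a box or substitute into one of them.\<close>

lemma universal_filter_pair:
  assumes G: "universal_filter C P R G" and X: "X \<in> Obj C" and Y: "Y \<in> Obj C" and Z: "Z \<in> Obj C"
    and f: "f \<in> Hom C Z X" and g: "g \<in> Hom C Z Y"
    and \<alpha>: "\<alpha> \<in> carrier (P X)" and \<beta>: "\<beta> \<in> carrier (P Y)"
    and box: "box X \<alpha> Y \<beta> \<in> G (Prd C X Y)"
  shows "R f \<alpha> \<squnion>\<^bsub>P Z\<^esub> R g \<beta> \<in> G Z"
proof -
  obtain h where h: "h \<in> Hom C Z (Prd C X Y)"
    and eq: "R h (box X \<alpha> Y \<beta>) = R f \<alpha> \<squnion>\<^bsub>P Z\<^esub> R g \<beta>"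
    using R_pair_box[OF X Y f g \<alpha> \<beta>] .
  show ?thesis using universal_filter_reindex[OF G Z Prd_Obj[OF X Y] h box] unfolding eq .
qed

text \<open>Pairs the two projections in reverse order. Residuals vary only the first factor, so
  this symmetry gives access to the second.\<close>

lemma box_swap:
  assumes G: "universal_filter C P R G" and X: "X \<in> Obj C" and Y: "Y \<in> Obj C"
    and \<alpha>: "\<alpha> \<in> carrier (P X)" and \<beta>: "\<beta> \<in> carrier (P Y)"
    and "box X \<alpha> Y \<beta> \<in> G (Prd C X Y)"
  shows "box Y \<beta> X \<alpha> \<in> G (Prd C Y X)"
proof -
  interpret B: bool_alg "P (Prd C Y X)" using X Y P_bool_alg Prd_Obj by blast
  show ?thesis
    using universal_filter_pair[OF G X Y Prd_Obj[OF Y X] Pr2_Hom[OF Y X] Pr1_Hom[OF Y X] \<alpha> \<beta>] assms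
    unfolding box_def by (simp add: join_comm)
qed

section \<open>Residuals of a universal filter\<close>

text \<open>The filter analogue of a colon ideal: all \<beta> whose disjunction with \<rho> lies in
  \<open>G\<close>. Keeping \<rho> in a factor of its own makes the family stable under reindexing
  of \<beta>.\<close>

definition residual :: "('o \<Rightarrow> 'a set) \<Rightarrow> 'o \<Rightarrow> 'a \<Rightarrow> 'o \<Rightarrow> 'a set" where
  "residual G Y \<rho> X = {\<beta> \<in> carrier (P X). box X \<beta> Y \<rho> \<in> G (Prd C X Y)}"

text \<open>The reindexing of \<beta> along the first projection is in \<open>G\<close> and lies
  below the box, and \<open>G\<close> is upward closed.\<close>

lemma residual_extends:
  assumes G: "universal_filter C P R G" and Y: "Y \<in> Obj C" and \<rho>: "\<rho> \<in> carrier (P Y)"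
    and X: "X \<in> Obj C"
  shows "G X \<subseteq> residual G Y \<rho> X"
proof
  fix \<beta> assume \<beta>: "\<beta> \<in> G X"
  have \<beta>c: "\<beta> \<in> carrier (P X)" using universal_filter_closed[OF G X \<beta>] .
  have XY: "Prd C X Y \<in> Obj C" using X Y by (rule Prd_Obj)
  interpret B: bool_alg "P (Prd C X Y)" using P_bool_alg XY .
  have filt: "ba_filter (P (Prd C X Y)) (G (Prd C X Y))"
    using G XY unfolding universal_filter_def by blast
  have "R (Pr1 C X Y) \<beta> \<in> G (Prd C X Y)"
    using universal_filter_reindex[OF G XY X Pr1_Hom[OF X Y] \<beta>] .
  moreover have "R (Pr1 C X Y) \<beta> \<sqsubseteq>\<^bsub>P (Prd C X Y)\<^esub> box X \<beta> Y \<rho>"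
    unfolding box_def using box_components_closed[OF X Y \<beta>c \<rho>] by (rule B.join_left)
  ultimately show "\<beta> \<in> residual G Y \<rho> X"
    using ba_filterD(4)[OF filt] box_closed[OF X Y \<beta>c \<rho>] \<beta>c unfolding residual_def by blast
qed

lemma residual_universal_filter:
  assumes G: "universal_filter C P R G" and Y: "Y \<in> Obj C" and \<rho>: "\<rho> \<in> carrier (P Y)"
  shows "universal_filter C P R (residual G Y \<rho>)"
  unfolding universal_filter_def
proof (intro conjI ballI)
  fix W X f \<beta>
  assume W: "W \<in> Obj C" and X: "X \<in> Obj C" and f: "f \<in> Hom C W X"
    and \<beta>: "\<beta> \<in> residual G Y \<rho> X"
  have \<beta>c: "\<beta> \<in> carrier (P X)" and box: "box X \<beta> Y \<rho> \<in> G (Prd C X Y)"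
    using \<beta> unfolding residual_def by auto
  \<comment> \<open>Reindexing along the product of \<open>f\<close> with the identity of
    \<open>Y\<close>, given by its two components.\<close>
  have "R (Comp C f (Pr1 C W Y)) \<beta> \<squnion>\<^bsub>P (Prd C W Y)\<^esub> R (Pr2 C W Y) \<rho> \<in> G (Prd C W Y)"
    using universal_filter_pair[OF G X Y Prd_Obj[OF W Y] Comp_Hom[OF Pr1_Hom[OF W Y] f]
        Pr2_Hom[OF W Y] \<beta>c \<rho> box] .
  then have "box W (R f \<beta>) Y \<rho> \<in> G (Prd C W Y)"
    unfolding box_def using R_Comp[OF Pr1_Hom[OF W Y] f \<beta>c] by simp
  then show "R f \<beta> \<in> residual G Y \<rho> W"
    unfolding residual_def using R_closed[OF f \<beta>c] by blast
next
  fix X assume X: "X \<in> Obj C"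
  interpret A: bool_alg "P X" using P_bool_alg X .
  let ?Q = "Prd C X Y"
  have Q: "?Q \<in> Obj C" using X Y by (rule Prd_Obj)
  interpret B: bool_alg "P ?Q" using P_bool_alg Q .
  have filtX: "ba_filter (P X) (G X)" and filt: "ba_filter (P ?Q) (G ?Q)"
    using G X Q unfolding universal_filter_def by blast+
  note comp = box_components_closed[OF X Y _ \<rho>] and boxc = box_closed[OF X Y _ \<rho>]
  show "ba_filter (P X) (residual G Y \<rho> X)"
    unfolding ba_filter_def
  proof (intro conjI ballI impI)
    show "residual G Y \<rho> X \<subseteq> carrier (P X)" unfolding residual_def by blast
    show "\<top>\<^bsub>P X\<^esub> \<in> residual G Y \<rho> X"
      using residual_extends[OF G Y \<rho> X] ba_filterD(2)[OF filtX] by blast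
  next
    fix a b assume "a \<in> residual G Y \<rho> X" "b \<in> residual G Y \<rho> X"
    then have a: "a \<in> carrier (P X)" and b: "b \<in> carrier (P X)"
      and "box X a Y \<rho> \<in> G ?Q" "box X b Y \<rho> \<in> G ?Q"
      unfolding residual_def by auto
    then have "box X a Y \<rho> \<sqinter>\<^bsub>P ?Q\<^esub> box X b Y \<rho> \<in> G ?Q"
      using ba_filterD(3)[OF filt] by blast
    moreover have "box X a Y \<rho> \<sqinter>\<^bsub>P ?Q\<^esub> box X b Y \<rho> \<sqsubseteq>\<^bsub>P ?Q\<^esub> box X (a \<sqinter>\<^bsub>P X\<^esub> b) Y \<rho>"
      unfolding box_def bool_homD(2)[OF R_bool_hom[OF Pr1_Hom[OF X Y]] a b]
      using comp(1)[OF a] comp(1)[OF b] comp(2)[OF a] by (rule B.join_meet_distrib_le)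
    ultimately show "a \<sqinter>\<^bsub>P X\<^esub> b \<in> residual G Y \<rho> X"
      using ba_filterD(4)[OF filt] boxc[of "a \<sqinter>\<^bsub>P X\<^esub> b"] a b unfolding residual_def by simp
  next
    fix a b assume "a \<in> residual G Y \<rho> X" and b: "b \<in> carrier (P X)" and le: "a \<sqsubseteq>\<^bsub>P X\<^esub> b"
    then have a: "a \<in> carrier (P X)" and box: "box X a Y \<rho> \<in> G ?Q"
      unfolding residual_def by auto
    have "box X a Y \<rho> \<sqsubseteq>\<^bsub>P ?Q\<^esub> box X b Y \<rho>"
      unfolding box_def
      using R_mono[OF Pr1_Hom[OF X Y] Q X a b le] comp(1)[OF a] comp(1)[OF b] comp(2)[OF a]
      by (rule B.join_mono_left)
    then show "b \<in> residual G Y \<rho> X"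
      using ba_filterD(4)[OF filt box boxc[OF b]] b unfolding residual_def by blast
  qed
qed

section \<open>Maximal universal filters\<close>

text \<open>Nonemptiness supplies the top elements; for meets, comparability puts both elements into
  the larger of two members. The other closure conditions concern one element at a time.\<close>

lemma universal_filter_Union_chain:
  assumes ne: "\<G> \<noteq> {}" and filt: "\<And>G. G \<in> \<G> \<Longrightarrow> universal_filter C P R G"
    and chain: "\<And>G H. \<lbrakk>G \<in> \<G>; H \<in> \<G>\<rbrakk>
      \<Longrightarrow> (\<forall>X\<in>Obj C. G X \<subseteq> H X) \<or> (\<forall>X\<in>Obj C. H X \<subseteq> G X)"
  shows "universal_filter C P R (\<lambda>X. \<Union>G\<in>\<G>. G X)"
  unfolding universal_filter_def
proof (intro conjI ballI)
  fix X Y f \<alpha> assume "X \<in> Obj C" "Y \<in> Obj C" "f \<in> Hom C X Y" "\<alpha> \<in> (\<Union>G\<in>\<G>. G Y)"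
  then show "R f \<alpha> \<in> (\<Union>G\<in>\<G>. G X)"
    by (auto intro: universal_filter_reindex[OF filt])
next
  fix X assume X: "X \<in> Obj C"
  have filtX: "ba_filter (P X) (G X)" if "G \<in> \<G>" for G
    using filt[OF that] X unfolding universal_filter_def by blast
  show "ba_filter (P X) (\<Union>G\<in>\<G>. G X)"
    unfolding ba_filter_def
  proof (intro conjI ballI impI)
    show "(\<Union>G\<in>\<G>. G X) \<subseteq> carrier (P X)" using ba_filterD(1)[OF filtX] by blast
    show "\<top>\<^bsub>P X\<^esub> \<in> (\<Union>G\<in>\<G>. G X)" using ba_filterD(2)[OF filtX] ne by blast
  next
    fix x y assume "x \<in> (\<Union>G\<in>\<G>. G X)" "y \<in> (\<Union>G\<in>\<G>. G X)"
    then obtain G H where GH: "G \<in> \<G>" "H \<in> \<G>" "x \<in> G X" "y \<in> H X" by blast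
    then obtain K where "K \<in> \<G>" "x \<in> K X" "y \<in> K X" using chain[of G H] X by blast
    then show "x \<sqinter>\<^bsub>P X\<^esub> y \<in> (\<Union>G\<in>\<G>. G X)" using ba_filterD(3)[OF filtX] by blast
  next
    fix x y assume "x \<in> (\<Union>G\<in>\<G>. G X)" "y \<in> carrier (P X)" "x \<sqsubseteq>\<^bsub>P X\<^esub> y"
    then show "y \<in> (\<Union>G\<in>\<G>. G X)" using ba_filterD(4)[OF filtX] by blast
  qed
qed

text \<open>Zorn's lemma applies because containing \<open>F\<close> and avoiding \<open>I\<close>
  both pass to unions of nonempty chains.\<close>

lemma ex_maximal_universal_filter:
  assumes F: "universal_filter C P R F" and disj: "\<forall>X\<in>Obj C. F X \<inter> I X = {}"
  shows "\<exists>G. universal_filter C P R G \<and> (\<forall>X\<in>Obj C. F X \<subseteq> G X \<and> G X \<inter> I X = {}) \<and>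
    (\<forall>H. universal_filter C P R H \<longrightarrow> (\<forall>X\<in>Obj C. G X \<subseteq> H X \<and> H X \<inter> I X = {}) \<longrightarrow>
      (\<forall>X\<in>Obj C. H X = G X))"
proof -
  define good where "good G \<longleftrightarrow> universal_filter C P R G
    \<and> (\<forall>X\<in>Obj C. F X \<subseteq> G X \<and> G X \<inter> I X = {})" for G
  \<comment> \<open>Families are encoded by their graphs over \<open>Obj C\<close>, so that values outside \<open>Obj C\<close> do not
    interfere with maximality.\<close>
  define \<A> where "\<A> = Sigma (Obj C) ` Collect good"
  have "good F" using F disj unfolding good_def by blast
  then have "\<A> \<noteq> {}" unfolding \<A>_def by blast
  moreover have "\<Union>\<C> \<in> \<A>" if ne: "\<C> \<noteq> {}" and ch: "subset.chain \<A> \<C>" for \<C>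
  proof -
    \<comment> \<open>A chain of graphs is turned back into families. Families differing only
      outside \<open>Obj C\<close> share a graph, and all of them are collected.\<close>
    define \<G> where "\<G> = {G. good G \<and> Sigma (Obj C) G \<in> \<C>}"
    have \<C>: "\<C> = Sigma (Obj C) ` \<G>"
      using ch unfolding \<G>_def \<A>_def subset.chain_def by blast
    have ne': "\<G> \<noteq> {}" using ne \<C> by blast
    have goodG: "good G" if "G \<in> \<G>" for G using that unfolding \<G>_def by blast
    have chain: "(\<forall>X\<in>Obj C. G X \<subseteq> H X) \<or> (\<forall>X\<in>Obj C. H X \<subseteq> G X)"
      if "G \<in> \<G>" "H \<in> \<G>" for G H
    proof -
      have "Sigma (Obj C) G \<subseteq> Sigma (Obj C) H \<or> Sigma (Obj C) H \<subseteq> Sigma (Obj C) G"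
        using ch that unfolding \<G>_def subset_chain_def by auto
      then show ?thesis unfolding Sigma_subset_iff .
    qed
    have "universal_filter C P R (\<lambda>X. \<Union>G\<in>\<G>. G X)"
      using ne' goodG chain by (intro universal_filter_Union_chain) (auto simp: good_def)
    moreover have "F X \<subseteq> (\<Union>G\<in>\<G>. G X)" "(\<Union>G\<in>\<G>. G X) \<inter> I X = {}" if X: "X \<in> Obj C" for X
    proof -
      have "F X \<subseteq> G X" "G X \<inter> I X = {}" if "G \<in> \<G>" for G
        using goodG[OF that] X unfolding good_def by auto
      then show "F X \<subseteq> (\<Union>G\<in>\<G>. G X)" "(\<Union>G\<in>\<G>. G X) \<inter> I X = {}"
        using ne' by blast+
    qed
    ultimately have "good (\<lambda>X. \<Union>G\<in>\<G>. G X)" unfolding good_def by simp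
    moreover have "\<Union>\<C> = Sigma (Obj C) (\<lambda>X. \<Union>G\<in>\<G>. G X)"
      unfolding \<C> by auto
    ultimately show ?thesis unfolding \<A>_def by simp
  qed
  ultimately have "\<exists>M\<in>\<A>. \<forall>N\<in>\<A>. M \<subseteq> N \<longrightarrow> N = M"
    by (rule subset_Zorn_nonempty)
  then obtain G where G: "good G"
    and max: "\<And>H. \<lbrakk>good H; Sigma (Obj C) G \<subseteq> Sigma (Obj C) H\<rbrakk> \<Longrightarrow> Sigma (Obj C) H = Sigma (Obj C) G"
    unfolding \<A>_def by auto
  have "\<forall>X\<in>Obj C. H X = G X"
    if H: "universal_filter C P R H" and GH: "\<forall>X\<in>Obj C. G X \<subseteq> H X \<and> H X \<inter> I X = {}" for H
  proof -
    have "good H" using G H GH unfolding good_def by (meson order_trans)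
    moreover have "Sigma (Obj C) G \<subseteq> Sigma (Obj C) H"
      using GH unfolding Sigma_subset_iff by simp
    ultimately have "Sigma (Obj C) H = Sigma (Obj C) G" by (rule max)
    then have "Sigma (Obj C) H \<subseteq> Sigma (Obj C) G" by simp
    then show ?thesis using GH unfolding Sigma_subset_iff by (meson subset_antisym)
  qed
  then show ?thesis using G unfolding good_def by (intro exI[of _ G] conjI allI impI) simp_all
qed

end

section \<open>Primeness of a maximal universal filter\<close>

theorem theorem3p18:
  fixes C :: "('o, 'm, 'r) fp_category_data_scheme"
    and P :: "'o \<Rightarrow> ('a, 'b) gorder_scheme"
    and R :: "'m \<Rightarrow> 'a \<Rightarrow> 'a"
    and F I :: "'o \<Rightarrow> 'a set"
  assumes "boolean_doctrine C P R"
    and "universal_filter C P R F"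
    and "universal_ideal C P R I"
    and "\<And>X. X \<in> Obj C \<Longrightarrow> F X \<inter> I X = {}"
  shows "\<exists>G. universal_ultrafilter C P R G \<and> (\<forall>X\<in>Obj C. F X \<subseteq> G X \<and> G X \<inter> I X = {})"
proof -
  interpret boolean_doctrine C P R by fact
  have disj: "\<forall>X\<in>Obj C. F X \<inter> I X = {}" using assms(4) by simp
  obtain G where G: "universal_filter C P R G"
    and FGI: "\<forall>X\<in>Obj C. F X \<subseteq> G X \<and> G X \<inter> I X = {}"
    and max: "\<forall>H. universal_filter C P R H \<longrightarrow> (\<forall>X\<in>Obj C. G X \<subseteq> H X \<and> H X \<inter> I X = {})
      \<longrightarrow> (\<forall>X\<in>Obj C. H X = G X)"
    using ex_maximal_universal_filter[OF assms(2) disj] by (elim exE conjE) (rule that)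
  have GI: "G X \<inter> I X = {}" if "X \<in> Obj C" for X
    using FGI that by simp
  have I_closed: "I X \<subseteq> carrier (P X)" if "X \<in> Obj C" for X
    using assms(3) that unfolding universal_ideal_def by blast
  have I_box: "box X \<alpha> Y \<beta> \<in> I (Prd C X Y)"
    if "X \<in> Obj C" "Y \<in> Obj C" "\<alpha> \<in> I X" "\<beta> \<in> I Y" for X Y \<alpha> \<beta>
    using assms(3) that unfolding universal_ideal_def box_def by blast
  have I_bot: "\<bottom>\<^bsub>P (Term C)\<^esub> \<in> I (Term C)"
    using assms(3) unfolding universal_ideal_def by blast
  \<comment> \<open>Trades the first factor of a box in \<open>G\<close> for an element of
    \<open>I\<close>, possibly over another object, while \<rho> stays fixed.\<close>
  have replace: "\<exists>Z\<in>Obj C. \<exists>\<beta>\<in>I Z. box Z \<beta> Y \<rho> \<in> G (Prd C Z Y)"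
    if X: "X \<in> Obj C" and Y: "Y \<in> Obj C" and \<alpha>: "\<alpha> \<in> carrier (P X)" and \<rho>: "\<rho> \<in> carrier (P Y)"
      and box: "box X \<alpha> Y \<rho> \<in> G (Prd C X Y)" and notin: "\<alpha> \<notin> G X" for X Y \<alpha> \<rho>
  proof (rule ccontr)
    assume "\<not> ?thesis"
    \<comment> \<open>The negated claim says exactly that the residual at \<rho> misses
      \<open>I\<close> in every fiber, so maximality collapses it to \<open>G\<close>. But \<alpha>
      lies in the residual and not in \<open>G\<close>.\<close>
    then have "\<forall>Z\<in>Obj C. G Z \<subseteq> residual G Y \<rho> Z \<and> residual G Y \<rho> Z \<inter> I Z = {}"
      using residual_extends[OF G Y \<rho>] unfolding residual_def by blast
    with max residual_universal_filter[OF G Y \<rho>] have "\<forall>Z\<in>Obj C. residual G Y \<rho> Z = G Z"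
      by (elim allE[of _ "residual G Y \<rho>"] impE)
    then have "residual G Y \<rho> X = G X" using X by (rule bspec)
    then show False using \<alpha> box notin unfolding residual_def by blast
  qed
  have prime: "\<alpha>1 \<in> G X1 \<or> \<alpha>2 \<in> G X2"
    if X1: "X1 \<in> Obj C" and X2: "X2 \<in> Obj C"
      and \<alpha>1: "\<alpha>1 \<in> carrier (P X1)" and \<alpha>2: "\<alpha>2 \<in> carrier (P X2)"
      and box: "box X1 \<alpha>1 X2 \<alpha>2 \<in> G (Prd C X1 X2)" for X1 X2 \<alpha>1 \<alpha>2
  proof (rule ccontr)
    assume neg: "\<not> ?thesis"
    then obtain Z1 \<beta>1 where Z1: "Z1 \<in> Obj C" and \<beta>1: "\<beta>1 \<in> I Z1"
      and "box Z1 \<beta>1 X2 \<alpha>2 \<in> G (Prd C Z1 X2)"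
      using replace[OF X1 X2 \<alpha>1 \<alpha>2 box] by blast
    moreover have \<beta>1c: "\<beta>1 \<in> carrier (P Z1)" using I_closed[OF Z1] \<beta>1 by blast
    \<comment> \<open>The swap brings \<alpha>2 into the replaceable position; \<beta>1 now serves
      as the fixed parameter of the second replacement.\<close>
    ultimately have "box X2 \<alpha>2 Z1 \<beta>1 \<in> G (Prd C X2 Z1)"
      using box_swap[OF G Z1 X2 _ \<alpha>2] by blast
    then obtain Z2 \<beta>2 where Z2: "Z2 \<in> Obj C" and \<beta>2: "\<beta>2 \<in> I Z2"
      and "box Z2 \<beta>2 Z1 \<beta>1 \<in> G (Prd C Z2 Z1)"
      using replace[OF X2 Z1 \<alpha>2 \<beta>1c] neg by blast
    \<comment> \<open>A box of two elements of \<open>I\<close> is in \<open>I\<close>, yet this one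
      is in \<open>G\<close>.\<close>
    then show False using I_box[OF Z2 Z1 \<beta>2 \<beta>1] GI[OF Prd_Obj[OF Z2 Z1]] by blast
  qed
  have "universal_ultrafilter C P R G"
    unfolding universal_ultrafilter_def
  proof (intro conjI)
    show "\<bottom>\<^bsub>P (Term C)\<^esub> \<notin> G (Term C)" using GI[OF Term_Obj] I_bot by blast
  qed (use G prime in \<open>simp_all add: universal_filter_def box_def\<close>)
  with FGI show ?thesis by (intro exI[of _ G] conjI)
qed

end
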